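(* Let $L$ be an $(n+1)$-dimensional complex Leibniz algebra ($n\ge3$) with adapted basis $\{e_0,\dots,e_n\}$, and let $a_2,\dots,a_n,b_n\in\mathbb{C}$. 1) If $L$ belongs to the family $\mu_1^{\overline{\alpha},\theta}$ in the basis $\{e_0,\dots,e_n\}$, then the basis transformation $$g=\tau(a_n,b_n,n)\circ\tau(a_{n-1},a_{n-1},n-1)\circ\cdots\circ\tau(a_2,a_2,2)$$ does not change the structural constants of $L$; that is, the multiplication of $L$ in the basis $\{g(e_0),\dots,g(e_n)\}$ has the form $\mu_1^{\overline{\alpha},\theta}$ with the same parameters $\alpha_3,\dots,\alpha_n,\theta$. 2) If $L$ belongs to the family $\mu_2^{\overline{\beta},\gamma}$ in the basis $\{e_0,\dots,e_n\}$, then the basis transformation $$\varphi=\sigma(b_n,n)\circ\eta(a_n,n)\circ\eta(a_{n-1},n-1)\circ\cdots\circ\eta(a_2,2)$$ does not change the structural constants of $L$; that is, the multiplication of $L$ in the basis $\{\varphi(e_0),\dots,\varphi(e_n)\}$ has the form $\mu_2^{\overline{\beta},\gamma}$ with the same parameters $\beta_3,\dots,\beta_n,\gamma$.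
   Context: All algebras are over $\mathbb{C}$. A Leibniz algebra is a vector space with a bilinear product $[-,-]$ satisfying $[x,[y,z]]=[[x,y],z]-[[x,z],y]$. Products of basis elements that are not listed are zero. Family $\mu_1^{\overline{\alpha},\theta}$ (parameters $\alpha_3,\dots,\alpha_n,\theta\in\mathbb{C}$), in a basis $\{e_0,\dots,e_n\}$: $[e_0,e_0]=e_2$; $[e_i,e_0]=e_{i+1}$ for $1\le i\le n-1$; $[e_0,e_1]=\alpha_3e_3+\dots+\alpha_{n-1}e_{n-1}+\theta e_n$; $[e_j,e_1]=\alpha_3e_{j+2}+\alpha_4e_{j+3}+\dots+\alpha_{n+1-j}e_n$ for $1\le j\le n-2$. Family $\mu_2^{\overline{\beta},\gamma}$ (parameters $\beta_3,\dots,\beta_n,\gamma\in\mathbb{C}$): $[e_0,e_0]=e_2$; $[e_i,e_0]=e_{i+1}$ for $2\le i\le n-1$; $[e_0,e_1]=\beta_3e_3+\dots+\beta_ne_n$; $[e_1,e_1]=\gamma e_n$; $[e_j,e_1]=\beta_3e_{j+2}+\beta_4e_{j+3}+\dots+\beta_{n+1-j}e_n$ for $2\le j\le n-2$. A basis is adapted if the multiplication in it has one of these two forms for some values of the parameters. The following are linear maps $f$ of the underlying vector space of $L$, given on the basis $\{e_0,\dots,e_n\}$ (with $[\,,]$ the product of $L$, $a,b\in\mathbb{C}$); in each case $f(e_2)=[f(e_0),f(e_0)]$. - For $L$ in $\mu_1^{\overline{\alpha},\theta}$: $\tau(a,b,k)$, $2\le k\le n$: $f(e_0)=e_0+ae_k$,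 $f(e_1)=e_1+be_k$, $f(e_{i+1})=[f(e_i),f(e_0)]$ for $1\le i\le n-1$ (used here with $a=b$ when $k<n$). - For $L$ in $\mu_2^{\overline{\beta},\gamma}$: $\sigma(b,n)$: $f(e_0)=e_0$, $f(e_1)=e_1+be_n$, $f(e_{i+1})=[f(e_i),f(e_0)]$ for $2\le i\le n-1$; and $\eta(a,k)$, $2\le k\le n$: $f(e_0)=e_0+ae_k$, $f(e_1)=e_1$, $f(e_{i+1})=[f(e_i),f(e_0)]$ for $2\le i\le n-1$. The symbol $\circ$ denotes composition of linear maps. *)

theory Defs
  imports Complex_Main
begin

locale leibniz_algebra = vector_space scale
  for scale :: "complex \<Rightarrow> 'a::ab_group_add \<Rightarrow> 'a" +
  fixes br :: "'a \<Rightarrow> 'a \<Rightarrow> 'a"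
  assumes linear_right: "Vector_Spaces.linear scale scale (br x)"
    and linear_left: "Vector_Spaces.linear scale scale (\<lambda>x. br x y)"
    and leibniz: "br x (br y z) = br (br x y) z - br (br x z) y"

text \<open>The vectors \<open>e 0, \<dots>, e n\<close> are pairwise distinct and form a basis of the whole type,
  which therefore has dimension \<open>n + 1\<close>; values \<open>e i\<close> with \<open>i > n\<close> are irrelevant.\<close>

definition indexed_basis ::
    "(complex \<Rightarrow> 'a::ab_group_add \<Rightarrow> 'a) \<Rightarrow> nat \<Rightarrow> (nat \<Rightarrow> 'a) \<Rightarrow> bool" where
  "indexed_basis scale n e \<longleftrightarrow>
     inj_on e {0..n} \<and> \<not> module.dependent scale (e ` {0..n}) \<and>
     module.span scale (e ` {0..n}) = UNIV"

text \<open>In the two tables below, entry \<open>i, j\<close> is the product of \<open>e i\<close> and \<open>e j\<close>. Only the parameters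
  \<open>\<alpha> 3, \<dots>, \<alpha> n\<close> (resp. \<open>\<beta> 3, \<dots>, \<beta> n\<close>) occur.\<close>

definition mu1_table ::
    "(complex \<Rightarrow> 'a::ab_group_add \<Rightarrow> 'a) \<Rightarrow> nat \<Rightarrow> (nat \<Rightarrow> complex) \<Rightarrow> complex
      \<Rightarrow> (nat \<Rightarrow> 'a) \<Rightarrow> nat \<Rightarrow> nat \<Rightarrow> 'a" where
  "mu1_table scale n \<alpha> \<theta> e i j =
    (if i = 0 \<and> j = 0 then e 2
     else if 1 \<le> i \<and> i \<le> n - 1 \<and> j = 0 then e (i + 1)
     else if i = 0 \<and> j = 1 then (\<Sum>m = 3..n - 1. scale (\<alpha> m) (e m)) + scale \<theta> (e n)
     else if 1 \<le> i \<and> i \<le> n - 2 \<and> j = 1 then (\<Sum>m = 3..n + 1 - i. scale (\<alpha> m) (e (m + i - 1)))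
     else 0)"

definition mu2_table ::
    "(complex \<Rightarrow> 'a::ab_group_add \<Rightarrow> 'a) \<Rightarrow> nat \<Rightarrow> (nat \<Rightarrow> complex) \<Rightarrow> complex
      \<Rightarrow> (nat \<Rightarrow> 'a) \<Rightarrow> nat \<Rightarrow> nat \<Rightarrow> 'a" where
  "mu2_table scale n \<beta> \<gamma> e i j =
    (if i = 0 \<and> j = 0 then e 2
     else if 2 \<le> i \<and> i \<le> n - 1 \<and> j = 0 then e (i + 1)
     else if i = 0 \<and> j = 1 then (\<Sum>m = 3..n. scale (\<beta> m) (e m))
     else if i = 1 \<and> j = 1 then scale \<gamma> (e n)
     else if 2 \<le> i \<and> i \<le> n - 2 \<and> j = 1 then (\<Sum>m = 3..n + 1 - i. scale (\<beta> m) (e (m + i - 1)))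
     else 0)"

definition mu1_form ::
    "(complex \<Rightarrow> 'a::ab_group_add \<Rightarrow> 'a) \<Rightarrow> ('a \<Rightarrow> 'a \<Rightarrow> 'a) \<Rightarrow> nat \<Rightarrow> (nat \<Rightarrow> complex) \<Rightarrow> complex
      \<Rightarrow> (nat \<Rightarrow> 'a) \<Rightarrow> bool" where
  "mu1_form scale br n \<alpha> \<theta> e \<longleftrightarrow> indexed_basis scale n e \<and>
     (\<forall>i\<le>n. \<forall>j\<le>n. br (e i) (e j) = mu1_table scale n \<alpha> \<theta> e i j)"

definition mu2_form ::
    "(complex \<Rightarrow> 'a::ab_group_add \<Rightarrow> 'a) \<Rightarrow> ('a \<Rightarrow> 'a \<Rightarrow> 'a) \<Rightarrow> nat \<Rightarrow> (nat \<Rightarrow> complex) \<Rightarrow> complex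
      \<Rightarrow> (nat \<Rightarrow> 'a) \<Rightarrow> bool" where
  "mu2_form scale br n \<beta> \<gamma> e \<longleftrightarrow> indexed_basis scale n e \<and>
     (\<forall>i\<le>n. \<forall>j\<le>n. br (e i) (e j) = mu2_table scale n \<beta> \<gamma> e i j)"

definition adapted_basis ::
    "(complex \<Rightarrow> 'a::ab_group_add \<Rightarrow> 'a) \<Rightarrow> ('a \<Rightarrow> 'a \<Rightarrow> 'a) \<Rightarrow> nat \<Rightarrow> (nat \<Rightarrow> 'a) \<Rightarrow> bool" where
  "adapted_basis scale br n e \<longleftrightarrow>
     (\<exists>\<alpha> \<theta>. mu1_form scale br n \<alpha> \<theta> e) \<or> (\<exists>\<beta> \<gamma>. mu2_form scale br n \<beta> \<gamma> e)"

text \<open>The linear map sending \<open>e i\<close> to \<open>w i\<close> for \<open>i \<le> n\<close>.\<close>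

definition linear_ext ::
    "(complex \<Rightarrow> 'a::ab_group_add \<Rightarrow> 'a) \<Rightarrow> nat \<Rightarrow> (nat \<Rightarrow> 'a) \<Rightarrow> (nat \<Rightarrow> 'a) \<Rightarrow> 'a \<Rightarrow> 'a" where
  "linear_ext scale n e w =
     vector_space_pair.construct scale scale (e ` {0..n}) (\<lambda>v. w (inv_into {0..n} e v))"

text \<open>Images of the basis vectors under a map \<open>f\<close> of one of the two kinds, where \<open>u = f (e 0)\<close> and
  \<open>v = f (e 1)\<close>. In the first kind, \<open>f (e 2)\<close> is computed as the product of \<open>f (e 1)\<close> and \<open>f (e 0)\<close>;
  lemma \<open>tau_eqs\<close> shows that it is also the square of \<open>f (e 0)\<close>.\<close>

fun images1 :: "('a \<Rightarrow> 'a \<Rightarrow> 'a) \<Rightarrow> 'a \<Rightarrow> 'a \<Rightarrow> nat \<Rightarrow> 'a" where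
  "images1 br u v 0 = u"
| "images1 br u v (Suc 0) = v"
| "images1 br u v (Suc (Suc i)) = br (images1 br u v (Suc i)) u"

fun images2 :: "('a \<Rightarrow> 'a \<Rightarrow> 'a) \<Rightarrow> 'a \<Rightarrow> 'a \<Rightarrow> nat \<Rightarrow> 'a" where
  "images2 br u v 0 = u"
| "images2 br u v (Suc 0) = v"
| "images2 br u v (Suc (Suc 0)) = br u u"
| "images2 br u v (Suc (Suc (Suc i))) = br (images2 br u v (Suc (Suc i))) u"

lemma images2_step: "2 \<le> i \<Longrightarrow> images2 br u v (Suc i) = br (images2 br u v i) u"
  by (cases "(br, u, v, i)" rule: images2.cases) auto

definition tau ::
    "(complex \<Rightarrow> 'a::ab_group_add \<Rightarrow> 'a) \<Rightarrow> ('a \<Rightarrow> 'a \<Rightarrow> 'a) \<Rightarrow> nat \<Rightarrow> (nat \<Rightarrow> 'a)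
      \<Rightarrow> complex \<Rightarrow> complex \<Rightarrow> nat \<Rightarrow> 'a \<Rightarrow> 'a" where
  "tau scale br n e a b k =
     linear_ext scale n e (images1 br (e 0 + scale a (e k)) (e 1 + scale b (e k)))"

definition sigma ::
    "(complex \<Rightarrow> 'a::ab_group_add \<Rightarrow> 'a) \<Rightarrow> ('a \<Rightarrow> 'a \<Rightarrow> 'a) \<Rightarrow> nat \<Rightarrow> (nat \<Rightarrow> 'a)
      \<Rightarrow> complex \<Rightarrow> nat \<Rightarrow> 'a \<Rightarrow> 'a" where
  "sigma scale br n e b k =
     linear_ext scale n e (images2 br (e 0) (e 1 + scale b (e k)))"

definition eta ::
    "(complex \<Rightarrow> 'a::ab_group_add \<Rightarrow> 'a) \<Rightarrow> ('a \<Rightarrow> 'a \<Rightarrow> 'a) \<Rightarrow> nat \<Rightarrow> (nat \<Rightarrow> 'a)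
      \<Rightarrow> complex \<Rightarrow> nat \<Rightarrow> 'a \<Rightarrow> 'a" where
  "eta scale br n e a k =
     linear_ext scale n e (images2 br (e 0 + scale a (e k)) (e 1))"

text \<open>\<open>comp_upto F m\<close> is \<open>F m \<circ> F (m - 1) \<circ> \<dots> \<circ> F 2\<close>, where \<open>F 2\<close> is applied first.\<close>

definition comp_upto :: "(nat \<Rightarrow> 'a \<Rightarrow> 'a) \<Rightarrow> nat \<Rightarrow> 'a \<Rightarrow> 'a" where
  "comp_upto F m = fold (\<lambda>k f. F k \<circ> f) [2..<Suc m] id"

lemma comp_upto_simps:
  "comp_upto F 2 = F 2"
  "2 \<le> m \<Longrightarrow> comp_upto F (Suc m) = F (Suc m) \<circ> comp_upto F m"
  by (simp_all add: comp_upto_def)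

context leibniz_algebra
begin

lemma linear_ext_linear:
  assumes "indexed_basis scale n e"
  shows "Vector_Spaces.linear scale scale (linear_ext scale n e w)"
proof -
  interpret p: vector_space_pair scale scale ..
  show ?thesis
    using assms p.linear_construct unfolding linear_ext_def indexed_basis_def by blast
qed

lemma linear_ext_basis:
  assumes "indexed_basis scale n e" "i \<le> n"
  shows "linear_ext scale n e w (e i) = w i"
proof -
  interpret p: vector_space_pair scale scale ..
  show ?thesis
    using assms p.construct_basis[of "e ` {0..n}" "e i"]
    unfolding linear_ext_def indexed_basis_def by (simp add: inv_into_f_f)
qed

lemma br_add_left: "br (x + y) z = br x z + br y z"
  and br_scale_left: "br (scale c x) z = scale c (br x z)"
  using linear_left[of z] by (auto simp: Vector_Spaces.linear_iff)

lemma br_add_right: "br x (y + z) = br x y + br x z"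
  and br_scale_right: "br x (scale c y) = scale c (br x y)"
  using linear_right[of x] by (auto simp: Vector_Spaces.linear_iff)

lemma tau_eqs:
  fixes a b k
  assumes "mu1_form scale br n \<alpha> \<theta> e" "3 \<le> n" "2 \<le> k" "k \<le> n" "k < n \<Longrightarrow> a = b"
  defines "f \<equiv> tau scale br n e a b k"
  shows "Vector_Spaces.linear scale scale f"
    and "f (e 0) = e 0 + scale a (e k)"
    and "f (e 1) = e 1 + scale b (e k)"
    and "f (e 2) = br (f (e 0)) (f (e 0))"
    and "\<And>i. 1 \<le> i \<Longrightarrow> i \<le> n - 1 \<Longrightarrow> f (e (i + 1)) = br (f (e i)) (f (e 0))"
proof -
  have B: "indexed_basis scale n e"
    and T: "\<And>i j. i \<le> n \<Longrightarrow> j \<le> n \<Longrightarrow> br (e i) (e j) = mu1_table scale n \<alpha> \<theta> e i j"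
    using assms(1) by (auto simp: mu1_form_def)
  note ev = linear_ext_basis[OF B]
  show "Vector_Spaces.linear scale scale f"
    unfolding f_def tau_def by (rule linear_ext_linear[OF B])
  show f0: "f (e 0) = e 0 + scale a (e k)" and f1: "f (e 1) = e 1 + scale b (e k)"
    using assms(2) by (simp_all add: f_def tau_def ev)
  show rec: "f (e (i + 1)) = br (f (e i)) (f (e 0))" if "1 \<le> i" "i \<le> n - 1" for i
    using that assms(2) by (cases i) (simp_all add: f_def tau_def ev)
  have z: "br (e i) (e k) = 0" if "i \<le> n" for i
    using that assms(2-4) by (simp add: T mu1_table_def)
  have "e (Suc 1) = br (e 1) (e 0)" "br (e 0) (e 0) = e (Suc 1)"
    using assms(2) by (auto simp: T mu1_table_def numeral_2_eq_2)
  moreover have "scale a (br (e k) (e 0)) = scale b (br (e k) (e 0))"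
  proof (cases "k < n")
    case False
    then have "k = n" "\<not> n \<le> n - 1" using assms(2,4) by simp_all
    then show ?thesis using assms(2) by (simp add: T mu1_table_def)
  qed (use assms(5) in simp)
  ultimately have "br (f (e 1)) (f (e 0)) = br (f (e 0)) (f (e 0))"
    using assms(2) unfolding f0 f1
    by (simp only: br_add_left br_add_right br_scale_left br_scale_right z scale_zero_right)
      (simp add: z assms(4))
  moreover have "f (e 2) = br (f (e 1)) (f (e 0))"
    using rec[of 1] assms(2) by (simp add: numeral_2_eq_2)
  ultimately show "f (e 2) = br (f (e 0)) (f (e 0))"
    by simp
qed

lemma sigma_eqs:
  fixes b k
  assumes "indexed_basis scale n e" "3 \<le> n"
  defines "f \<equiv> sigma scale br n e b k"
  shows "Vector_Spaces.linear scale scale f"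
    and "f (e 0) = e 0" and "f (e 1) = e 1 + scale b (e k)"
    and "f (e 2) = br (f (e 0)) (f (e 0))"
    and "\<And>i. 2 \<le> i \<Longrightarrow> i \<le> n - 1 \<Longrightarrow> f (e (i + 1)) = br (f (e i)) (f (e 0))"
  using assms(2) linear_ext_linear[OF assms(1)]
  by (auto simp: f_def sigma_def linear_ext_basis[OF assms(1)] images2_step numeral_2_eq_2)

lemma eta_eqs:
  fixes a k
  assumes "indexed_basis scale n e" "3 \<le> n"
  defines "f \<equiv> eta scale br n e a k"
  shows "Vector_Spaces.linear scale scale f"
    and "f (e 0) = e 0 + scale a (e k)" and "f (e 1) = e 1"
    and "f (e 2) = br (f (e 0)) (f (e 0))"
    and "\<And>i. 2 \<le> i \<Longrightarrow> i \<le> n - 1 \<Longrightarrow> f (e (i + 1)) = br (f (e i)) (f (e 0))"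
  using assms(2) linear_ext_linear[OF assms(1)]
  by (auto simp: f_def eta_def linear_ext_basis[OF assms(1)] images2_step numeral_2_eq_2)

end

end

theory Submission imports Defs begin

text \<open>
  Each of the maps \<open>\<tau>\<close>, \<open>\<sigma>\<close>, \<open>\<eta>\<close> in the two compositions is an automorphism of the Leibniz
  algebra. Automorphisms compose, and the image of a basis under an automorphism has the same
  structural constants.

  Both families are treated at once. Put \<open>e i = 0\<close> for \<open>i > n\<close>, and let \<open>R\<close> and \<open>S\<close> be right
  multiplication by \<open>e 0\<close> and by \<open>e 1\<close>. The vectors \<open>e 2, \<dots>, e n\<close> span an ideal \<open>I\<close> and annihilate
  everything from the right, so the product is determined by \<open>R\<close> and \<open>S\<close>. Here \<open>R\<close> sends \<open>e 0\<close> to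
  \<open>e 2\<close>, \<open>e 1\<close> to \<open>c\<cdot>e 2\<close> and \<open>e i\<close> to \<open>e (i + 1)\<close> for \<open>i \<ge> 2\<close>, where \<open>c = 1\<close> in the first family and
  \<open>c = 0\<close> in the second. With the polynomial \<open>p(R) = \<Sum>m. t m \<cdot> R ^ (m - 1)\<close>, the map \<open>S\<close> is \<open>p(R)\<close>
  on \<open>I\<close>, and on \<open>e 0\<close> and \<open>e 1\<close> it differs from \<open>p(R)\<close> by multiples of the last vector \<open>e n\<close> only.

  Each of the maps \<open>f\<close> adds \<open>a \<cdot> e k\<close> to \<open>e 0\<close> and \<open>b \<cdot> e k\<close> to \<open>e 1\<close>, for some \<open>k \<ge> 2\<close>. As \<open>e k\<close>
  annihilates from the right, right multiplication by \<open>f (e 0)\<close> and by \<open>f (e 1)\<close> is still \<open>R\<close> and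
  \<open>S\<close>. The recursion for \<open>f (e i)\<close> makes \<open>f\<close> equal to the shift
  \<open>e i \<mapsto> e i + a \<cdot> e (k + i - 1)\<close> on \<open>I\<close>. Hence \<open>f\<close> commutes with \<open>R\<close>; at \<open>e 1\<close> this uses that
  \<open>b = c \<cdot> a\<close> or \<open>k = n\<close>. Therefore \<open>f\<close> commutes with \<open>p(R)\<close>, and since it fixes \<open>e n\<close>, also with
  \<open>S\<close>. This is multiplicativity
  (\<open>shift_mult\<close>). Finally \<open>f\<close> is unitriangular in the basis, hence bijective (\<open>shift_bij\<close>).
\<close>

section \<open>Automorphisms and structural constants\<close>

context leibniz_algebra
begin

definition automorphism :: "('a \<Rightarrow> 'a) \<Rightarrow> bool" where
  "automorphism f \<longleftrightarrow> Vector_Spaces.linear scale scale f \<and> bij f \<and>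
     (\<forall>x y. f (br x y) = br (f x) (f y))"

lemma automorphism_comp:
  assumes "automorphism f" "automorphism g"
  shows "automorphism (f \<circ> g)"
  using assms unfolding automorphism_def
  by (auto simp: Vector_Spaces.linear_iff intro: bij_comp)

lemma automorphism_comp_upto:
  assumes "2 \<le> m" and "\<And>k. 2 \<le> k \<Longrightarrow> k \<le> m \<Longrightarrow> automorphism (F k)"
  shows "automorphism (comp_upto F m)"
  using assms
  by (induction m rule: dec_induct) (auto simp: comp_upto_simps intro: automorphism_comp)

lemma indexed_basis_automorphism:
  assumes "automorphism f" "indexed_basis scale n e"
  shows "indexed_basis scale n (\<lambda>i. f (e i))"
proof -
  interpret f: Vector_Spaces.linear scale scale f
    using assms(1) by (simp add: automorphism_def)
  have f: "inj f" "surj f"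
    using assms(1) by (auto simp: automorphism_def bij_def)
  have img: "(\<lambda>i. f (e i)) ` {0..n} = f ` (e ` {0..n})"
    by (simp add: image_image)
  have "inj_on (\<lambda>i. f (e i)) {0..n}"
    using comp_inj_on[of e "{0..n}" f] assms(2) f(1)
    by (auto simp: indexed_basis_def o_def inj_on_subset)
  moreover have "independent (f ` (e ` {0..n}))"
    using assms(2) f.independent_injective_image[OF _ inj_on_subset[OF f(1)]]
    by (auto simp: indexed_basis_def)
  ultimately show ?thesis
    using assms(2) f(2) by (simp add: indexed_basis_def img f.span_image)
qed

lemma mu1_form_automorphism:
  assumes "automorphism f" "mu1_form scale br n \<alpha> \<theta> e"
  shows "mu1_form scale br n \<alpha> \<theta> (\<lambda>i. f (e i))"
proof -
  interpret f: Vector_Spaces.linear scale scale f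
    using assms(1) by (simp add: automorphism_def)
  have "f (mu1_table scale n \<alpha> \<theta> e i j) = mu1_table scale n \<alpha> \<theta> (\<lambda>i. f (e i)) i j" for i j
    by (simp add: mu1_table_def f.add f.sum f.scale)
  then show ?thesis
    using assms indexed_basis_automorphism[OF assms(1), of n e]
    by (metis (no_types, lifting) automorphism_def mu1_form_def)
qed

lemma mu2_form_automorphism:
  assumes "automorphism f" "mu2_form scale br n \<beta> \<gamma> e"
  shows "mu2_form scale br n \<beta> \<gamma> (\<lambda>i. f (e i))"
proof -
  interpret f: Vector_Spaces.linear scale scale f
    using assms(1) by (simp add: automorphism_def)
  have "f (mu2_table scale n \<beta> \<gamma> e i j) = mu2_table scale n \<beta> \<gamma> (\<lambda>i. f (e i)) i j" for i j
    by (simp add: mu2_table_def f.sum f.scale)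
  then show ?thesis
    using assms indexed_basis_automorphism[OF assms(1), of n e]
    by (metis (no_types, lifting) automorphism_def mu2_form_def)
qed

lemma mult_from_spanning:
  assumes "Vector_Spaces.linear scale scale f" "span B = UNIV"
    and "\<And>u v. u \<in> B \<Longrightarrow> v \<in> B \<Longrightarrow> f (br u v) = br (f u) (f v)"
  shows "f (br x y) = br (f x) (f y)"
proof -
  interpret f: Vector_Spaces.linear scale scale f by fact
  have z: "br 0 v = 0" "br u 0 = 0" for u v
    using br_scale_left[of 0 0 v] br_scale_right[of u 0 0] by simp_all
  have *: "f (br u y) = br (f u) (f y)" if "u \<in> B" for u
  proof (rule span_induct_alt[of y B])
    show "y \<in> span B" using assms(2) by simp
  qed (use assms(3) that in \<open>simp_all add: z f.add f.scale f.zero br_add_right br_scale_right\<close>)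
  show ?thesis
  proof (rule span_induct_alt[of x B])
    show "x \<in> span B" using assms(2) by simp
  qed (use * in \<open>simp_all add: z f.add f.scale f.zero br_add_left br_scale_left\<close>)
qed

end

section \<open>A common normal form for the two families\<close>

text \<open>
  The basis is continued by zero beyond \<open>n\<close>, so that no product needs an upper bound on its index.
  The parameters \<open>\<delta>\<close> and \<open>\<gamma>\<close> measure how far \<open>S\<close> is from \<open>p(R)\<close> at \<open>E 0\<close> and \<open>E 1\<close>.
\<close>

locale shift_normal_form = leibniz_algebra scale br
  for scale :: "complex \<Rightarrow> 'a::ab_group_add \<Rightarrow> 'a" and br :: "'a \<Rightarrow> 'a \<Rightarrow> 'a" +
  fixes n :: nat and E :: "nat \<Rightarrow> 'a" and t :: "nat \<Rightarrow> complex" and c \<delta> \<gamma> :: complex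
  assumes n3: "3 \<le> n"
    and basis: "indexed_basis scale n E"
    and beyond: "n < i \<Longrightarrow> E i = 0"
    and R0: "br (E 0) (E 0) = E 2"
    and R1: "br (E 1) (E 0) = scale c (E 2)"
    and R: "2 \<le> i \<Longrightarrow> br (E i) (E 0) = E (i + 1)"
    and S0: "br (E 0) (E 1) = (\<Sum>m = 3..n. scale (t m) (E m)) + scale \<delta> (E n)"
    and S1: "br (E 1) (E 1) = scale c (\<Sum>m = 3..n. scale (t m) (E m)) + scale \<gamma> (E n)"
    and S: "2 \<le> i \<Longrightarrow> br (E i) (E 1) = (\<Sum>m = 3..n. scale (t m) (E (m + i - 1)))"
    and annihilate_basis: "i \<le> n \<Longrightarrow> 2 \<le> j \<Longrightarrow> j \<le> n \<Longrightarrow> br (E i) (E j) = 0"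
begin

lemma br_zero [simp]: "br 0 y = 0" "br x 0 = 0"
  using br_scale_left[of 0 0 y] br_scale_right[of x 0 0] by simp_all

lemma span_E: "span (E ` {0..n}) = UNIV"
  using basis by (simp add: indexed_basis_def)

lemma annihilate:
  assumes "2 \<le> j"
  shows "br x (E j) = 0"
proof (cases "j \<le> n")
  case True
  show ?thesis
  proof (rule span_induct_alt[of x "E ` {0..n}"])
    show "x \<in> span (E ` {0..n})" by (simp add: span_E)
  qed (use True assms annihilate_basis in \<open>auto simp: br_add_left br_scale_left\<close>)
qed (simp add: beyond)

text \<open>The vector \<open>p(R)(E i)\<close> for \<open>i \<ge> 2\<close>; for \<open>i = 1\<close> it is \<open>p(R)(E 0)\<close>.\<close>

definition T :: "nat \<Rightarrow> 'a" where
  "T i = (\<Sum>m = 3..n. scale (t m) (E (m + i - 1)))"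

lemma S_T:
  "br (E 0) (E 1) = T 1 + scale \<delta> (E n)"
  "br (E 1) (E 1) = scale c (T 1) + scale \<gamma> (E n)"
  "2 \<le> i \<Longrightarrow> br (E i) (E 1) = T i"
  using S0 S1 S by (simp_all add: T_def)

lemma T_beyond: "n \<le> i \<Longrightarrow> T i = 0"
  unfolding T_def by (intro sum.neutral) (auto simp: beyond)

end

text \<open>
  The hypothesis on the parameters says that \<open>f\<close> respects the relation \<open>R (E 1) = c \<cdot> R (E 0)\<close>:
  comparing coefficients gives \<open>(b - c * a) \<cdot> E (k + 1) = 0\<close>, which for \<open>k = n\<close> is vacuous.
\<close>

locale shift_map = shift_normal_form scale br n E t c \<delta> \<gamma>
  for scale :: "complex \<Rightarrow> 'a::ab_group_add \<Rightarrow> 'a" and br and n and E and t and c \<delta> \<gamma> +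
  fixes f :: "'a \<Rightarrow> 'a" and a b :: complex and k :: nat
  assumes lin: "Vector_Spaces.linear scale scale f"
    and k: "2 \<le> k" "k \<le> n"
    and ab: "k = n \<or> b = c * a"
    and f0: "f (E 0) = E 0 + scale a (E k)"
    and f1: "f (E 1) = E 1 + scale b (E k)"
    and f2: "f (E 2) = br (f (E 0)) (f (E 0))"
    and fstep: "2 \<le> i \<Longrightarrow> i \<le> n - 1 \<Longrightarrow> f (E (i + 1)) = br (f (E i)) (f (E 0))"
begin

sublocale f: Vector_Spaces.linear scale scale f
  by (fact lin)

lemma right_mult_f:
  "br x (f (E 0)) = br x (E 0)" "br x (f (E 1)) = br x (E 1)"
  using k(1) unfolding f0 f1 by (simp_all add: br_add_right br_scale_right annihilate)

lemma f_shift: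
  assumes "2 \<le> i"
  shows "f (E i) = E i + scale a (E (k + i - 1))"
  using assms
proof (induction i rule: dec_induct)
  case base
  have "br (f (E 0)) (E 0) = E 2 + scale a (E (k + 1))"
    using k by (simp add: f0 br_add_left br_scale_left R0 R)
  then show ?case by (simp add: f2 right_mult_f)
next
  case (step i)
  show ?case
  proof (cases "i \<le> n - 1")
    case True
    then have "f (E (i + 1)) = br (E i + scale a (E (k + i - 1))) (E 0)"
      using fstep[of i] step right_mult_f by simp
    then show ?thesis
      using step k by (simp add: br_add_left br_scale_left R)
  next
    case False
    then show ?thesis using k by (simp add: beyond f.zero)
  qed
qed

lemma f_T:
  assumes "1 \<le> i"
  shows "f (T i) = T i + scale a (T (k + i - 1))"
proof -
  have "f (T i) = (\<Sum>m = 3..n. scale (t m) (f (E (m + i - 1))))"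
    by (simp add: T_def f.sum f.scale)
  also have "\<dots> = (\<Sum>m = 3..n. scale (t m) (E (m + i - 1))
      + scale a (scale (t m) (E (m + (k + i - 1) - 1))))"
  proof (rule sum.cong)
    fix m assume "m \<in> {3..n}"
    then have "2 \<le> m + i - 1" "k + (m + i - 1) - 1 = m + (k + i - 1) - 1"
      using assms k by auto
    then show "scale (t m) (f (E (m + i - 1))) = scale (t m) (E (m + i - 1))
      + scale a (scale (t m) (E (m + (k + i - 1) - 1)))"
      by (simp only: f_shift) (simp add: scale_right_distrib scale_left_commute)
  qed simp
  finally show ?thesis
    by (simp add: T_def sum.distrib scale_sum_right)
qed

lemma f_last: "f (E n) = E n"
  using f_shift[of n] n3 k beyond[of "k + n - 1"] by simp

lemma shift_mult_basis:
  assumes "i \<le> n" "j \<le> n"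
  shows "f (br (E i) (E j)) = br (f (E i)) (f (E j))"
proof -
  \<comment> \<open>On vectors of index above \<open>k\<close>, \<open>b\<close> acts as \<open>c * a\<close>: when \<open>k = n\<close>, these vectors vanish.\<close>
  have bk1: "scale b (E (k + 1)) = scale (c * a) (E (k + 1))"
    and bT: "scale b (T k) = scale (c * a) (T k)"
    using ab by (auto simp: beyond T_beyond)
  consider "i = 0" | "i = 1" | "2 \<le> i" by linarith
  note i_cases = this
  consider "j = 0" | "j = 1" | "2 \<le> j" by linarith
  then show ?thesis
  proof cases
    case j: 1
    show ?thesis
      using i_cases
    proof cases
      case 1
      then show ?thesis by (simp add: j R0 f2)
    next
      case 2
      have "f (br (E 1) (E 0)) = scale c (E 2) + scale (c * a) (E (k + 1))"
        using f_shift[of 2] k by (simp add: R1[simplified] f.scale scale_right_distrib)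
      also have "\<dots> = br (f (E 1)) (E 0)"
        using k unfolding bk1[symmetric] f1 by (simp add: br_add_left br_scale_left R1[simplified] R)
      finally show ?thesis by (simp only: 2 j right_mult_f)
    next
      case 3
      then show ?thesis
        using k by (simp add: j right_mult_f f_shift R br_add_left br_scale_left)
    qed
  next
    case j: 2
    show ?thesis
      using i_cases
    proof cases
      case 1
      have "f (br (E 0) (E 1)) = T 1 + scale a (T k) + scale \<delta> (E n)"
        unfolding S_T using f_T[of 1] by (simp add: f.add f.scale f_last)
      also have "\<dots> = br (f (E 0)) (E 1)"
        unfolding f0 br_add_left br_scale_left S_T using S_T(3)[OF k(1)] by simp
      finally show ?thesis by (simp only: 1 j right_mult_f)
    next
      case 2
      have "f (br (E 1) (E 1)) = scale c (T 1) + scale (c * a) (T k) + scale \<gamma> (E n)"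
        unfolding S_T using f_T[of 1] by (simp add: f.add f.scale f_last scale_right_distrib)
      also have "\<dots> = br (f (E 1)) (E 1)"
        unfolding bT[symmetric] f1 br_add_left br_scale_left S_T
        using S_T(3)[OF k(1)] by simp
      finally show ?thesis by (simp only: 2 j right_mult_f)
    next
      case 3
      have "f (br (E i) (E 1)) = T i + scale a (T (k + i - 1))"
        using 3 f_T[of i] by (simp add: S_T(3)[simplified])
      also have "\<dots> = br (f (E i)) (E 1)"
        using 3 k by (simp add: f_shift br_add_left br_scale_left S_T(3)[simplified])
      finally show ?thesis by (simp only: j right_mult_f)
    qed
  next
    case 3
    then show ?thesis
      using k by (simp add: annihilate f_shift f.zero br_add_right br_scale_right)
  qed
qed

lemma shift_mult: "f (br x y) = br (f x) (f y)"
  by (rule mult_from_spanning[OF lin span_E]) (auto simp: shift_mult_basis)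

text \<open>
  Unitriangularity: \<open>f (E i) - E i\<close> is a multiple of a basis vector with larger index, so descending
  induction places every basis vector in the image. In finite dimension, onto implies injective.
\<close>

lemma shift_bij: "bij f"
proof -
  have sub: "subspace (range f)"
    using f.subspace_image[OF subspace_UNIV] .
  have tail: "E i \<in> range f" if "2 \<le> i" for i
    using that
  proof (induction "Suc n - i" arbitrary: i rule: less_induct)
    case less
    show ?case
    proof (cases "n < i")
      case True
      then show ?thesis using subspace_0[OF sub] by (simp add: beyond)
    next
      case False
      have "E (k + i - 1) \<in> range f"
        using False less k by simp
      then have "f (E i) - scale a (E (k + i - 1)) \<in> range f"
        using sub by (intro subspace_diff subspace_scale) auto
      then show ?thesis using less.prems by (simp add: f_shift)
    qed
  qed
  have "E i \<in> range f" for i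
  proof -
    have k': "E k \<in> range f" using tail k by simp
    have "f (E 0) - scale a (E k) \<in> range f" "f (E 1) - scale b (E k) \<in> range f"
      using sub k' by (auto intro!: subspace_diff subspace_scale)
    then have "E 0 \<in> range f" "E 1 \<in> range f"
      by (simp_all only: f0 f1 add_diff_cancel_right')
    moreover have "i = 0 \<or> i = 1 \<or> 2 \<le> i" by linarith
    ultimately show ?thesis using tail by blast
  qed
  then have "span (E ` {0..n}) \<subseteq> range f"
    using sub by (intro span_minimal) auto
  then have surj: "surj f"
    using span_E by auto
  interpret fin: finite_dimensional_vector_space scale "E ` {0..n}"
    using basis by unfold_locales (auto simp: indexed_basis_def)
  show ?thesis
    using fin.linear_surj_imp_inj[OF lin surj] surj by (simp add: bij_def)
qed

lemma shift_automorphism: "automorphism f"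
  using lin shift_bij shift_mult by (simp add: automorphism_def)

end

section \<open>The two families in normal form\<close>

context leibniz_algebra
begin

definition extend :: "nat \<Rightarrow> (nat \<Rightarrow> 'a) \<Rightarrow> nat \<Rightarrow> 'a" where
  "extend n e i = (if i \<le> n then e i else 0)"

lemma indexed_basis_extend:
  assumes "indexed_basis scale n e"
  shows "indexed_basis scale n (extend n e)"
proof -
  have "extend n e ` {0..n} = e ` {0..n}"
    by (intro image_cong) (auto simp: extend_def)
  moreover have "inj_on (extend n e) {0..n} = inj_on e {0..n}"
    by (intro inj_on_cong) (simp add: extend_def)
  ultimately show ?thesis using assms by (simp add: indexed_basis_def)
qed

lemma sum_extend:
  assumes "1 \<le> i"
  shows "(\<Sum>m = 3..n. scale (t m) (extend n e (m + i - 1)))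
    = (\<Sum>m = 3..n + 1 - i. scale (t m) (e (m + i - 1)))"
  using assms by (intro sum.mono_neutral_cong_right) (auto simp: extend_def)

lemma sum_extend_empty:
  assumes "n - 1 \<le> i"
  shows "(\<Sum>m = 3..n. scale (t m) (extend n e (m + i - 1))) = 0"
  using assms by (intro sum.neutral) (auto simp: extend_def)

text \<open>In the first family \<open>S (e 0)\<close> has \<open>\<theta>\<close> in place of \<open>\<alpha> n\<close> as its last coefficient,
  whence \<open>\<delta> = \<theta> - \<alpha> n\<close>.\<close>

lemma mu1_normal_form:
  assumes "mu1_form scale br n \<alpha> \<theta> e" "3 \<le> n"
  shows "shift_normal_form scale br n (extend n e) \<alpha> 1 (\<theta> - \<alpha> n) 0"
proof -
  have tab: "br (e i) (e j) = mu1_table scale n \<alpha> \<theta> e i j" if "i \<le> n" "j \<le> n" for i j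
    using assms that by (auto simp: mu1_form_def)
  have z: "br 0 y = 0" for y
    using br_scale_left[of 0 0 y] by simp
  have E: "extend n e i = e i" if "i \<le> n" for i
    using that by (simp add: extend_def)
  have sumE: "(\<Sum>m = 3..n. scale (\<alpha> m) (extend n e m)) = (\<Sum>m = 3..n. scale (\<alpha> m) (e m))"
    by (intro sum.cong) (auto simp: extend_def)
  have last: "(\<Sum>m = 3..n. scale (\<alpha> m) (e m))
      = (\<Sum>m = 3..n - 1. scale (\<alpha> m) (e m)) + scale (\<alpha> n) (e n)"
    using assms(2) by (cases n) (auto simp: sum.cl_ivl_Suc)
  show ?thesis
  proof unfold_locales
    show "indexed_basis scale n (extend n e)"
      using assms(1) by (auto simp: mu1_form_def intro: indexed_basis_extend)
    show "br (extend n e i) (extend n e 0) = extend n e (i + 1)" if "2 \<le> i" for i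
      using that assms(2) by (auto simp: extend_def tab mu1_table_def z)
    show "br (extend n e i) (extend n e 1)
        = (\<Sum>m = 3..n. scale (\<alpha> m) (extend n e (m + i - 1)))" if "2 \<le> i" for i
    proof (cases "i \<le> n - 2")
      case True
      have "br (extend n e i) (extend n e 1) = (\<Sum>m = 3..n + 1 - i. scale (\<alpha> m) (e (m + i - 1)))"
        using True that assms(2) by (simp add: E tab mu1_table_def)
      then show ?thesis using sum_extend[of i \<alpha> n e] that by simp
    next
      case False
      then have "br (extend n e i) (extend n e 1) = 0"
        using that assms(2) by (auto simp: extend_def tab mu1_table_def z)
      then show ?thesis using sum_extend_empty[of n i \<alpha> e] False by simp
    qed
  qed (use assms(2) in \<open>auto simp: E tab mu1_table_def extend_def[of _ _ "Suc n"]
      sumE last scale_left_diff_distrib numeral_2_eq_2, simp_all add: extend_def\<close>)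
qed

lemma mu2_normal_form:
  assumes "mu2_form scale br n \<beta> \<gamma> e" "3 \<le> n"
  shows "shift_normal_form scale br n (extend n e) \<beta> 0 0 \<gamma>"
proof -
  have tab: "br (e i) (e j) = mu2_table scale n \<beta> \<gamma> e i j" if "i \<le> n" "j \<le> n" for i j
    using assms that by (auto simp: mu2_form_def)
  have z: "br 0 y = 0" for y
    using br_scale_left[of 0 0 y] by simp
  have E: "extend n e i = e i" if "i \<le> n" for i
    using that by (simp add: extend_def)
  have sumE: "(\<Sum>m = 3..n. scale (\<beta> m) (extend n e m)) = (\<Sum>m = 3..n. scale (\<beta> m) (e m))"
    by (intro sum.cong) (auto simp: extend_def)
  show ?thesis
  proof unfold_locales
    show "indexed_basis scale n (extend n e)"
      using assms(1) by (auto simp: mu2_form_def intro: indexed_basis_extend)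
    show "br (extend n e i) (extend n e 0) = extend n e (i + 1)" if "2 \<le> i" for i
      using that assms(2) by (auto simp: extend_def tab mu2_table_def z)
    show "br (extend n e i) (extend n e 1)
        = (\<Sum>m = 3..n. scale (\<beta> m) (extend n e (m + i - 1)))" if "2 \<le> i" for i
    proof (cases "i \<le> n - 2")
      case True
      have "br (extend n e i) (extend n e 1) = (\<Sum>m = 3..n + 1 - i. scale (\<beta> m) (e (m + i - 1)))"
        using True that assms(2) by (simp add: E tab mu2_table_def)
      then show ?thesis using sum_extend[of i \<beta> n e] that by simp
    next
      case False
      then have "br (extend n e i) (extend n e 1) = 0"
        using that assms(2) by (auto simp: extend_def tab mu2_table_def z)
      then show ?thesis using sum_extend_empty[of n i \<beta> e] False by simp
    qed
  qed (use assms(2) in \<open>auto simp: E tab mu2_table_def sumE, simp_all add: extend_def\<close>)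
qed

lemma tau_automorphism:
  assumes "mu1_form scale br n \<alpha> \<theta> e" "3 \<le> n" "2 \<le> k" "k \<le> n" "k < n \<Longrightarrow> a = b"
  shows "automorphism (tau scale br n e a b k)"
proof -
  note eqs = tau_eqs[OF assms]
  have "k = n \<or> b = 1 * a"
    using assms(4,5) by (cases "k < n") auto
  then have "shift_map scale br n (extend n e) \<alpha> 1 (\<theta> - \<alpha> n) 0 (tau scale br n e a b k) a b k"
    using mu1_normal_form[OF assms(1,2)] assms(2-) eqs(5)
    by (auto simp: shift_map_def shift_map_axioms_def extend_def
        eqs(1,2,4) eqs(3)[simplified])
  then show ?thesis by (rule shift_map.shift_automorphism)
qed

lemma eta_automorphism:
  assumes "mu2_form scale br n \<beta> \<gamma> e" "3 \<le> n" "2 \<le> k" "k \<le> n"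
  shows "automorphism (eta scale br n e a k)"
proof -
  have "indexed_basis scale n e" using assms(1) by (simp add: mu2_form_def)
  note eqs = eta_eqs[OF this assms(2)]
  have "shift_map scale br n (extend n e) \<beta> 0 0 \<gamma> (eta scale br n e a k) a 0 k"
    using mu2_normal_form[OF assms(1,2)] assms(2-) eqs(5)
    by (auto simp: shift_map_def shift_map_axioms_def extend_def
        eqs(1,2,4) eqs(3)[simplified])
  then show ?thesis by (rule shift_map.shift_automorphism)
qed

lemma sigma_automorphism:
  assumes "mu2_form scale br n \<beta> \<gamma> e" "3 \<le> n"
  shows "automorphism (sigma scale br n e b n)"
proof -
  have "indexed_basis scale n e" using assms(1) by (simp add: mu2_form_def)
  note eqs = sigma_eqs[OF this assms(2)]
  have "shift_map scale br n (extend n e) \<beta> 0 0 \<gamma> (sigma scale br n e b n) 0 b n"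
    using mu2_normal_form[OF assms(1,2)] assms(2-) eqs(5)
    by (auto simp: shift_map_def shift_map_axioms_def extend_def
        eqs(1,2,4) eqs(3)[simplified])
  then show ?thesis by (rule shift_map.shift_automorphism)
qed

end

theorem proposition3p6:
  fixes scale :: "complex \<Rightarrow> 'a::ab_group_add \<Rightarrow> 'a"
    and br :: "'a \<Rightarrow> 'a \<Rightarrow> 'a"
    and n :: nat and e :: "nat \<Rightarrow> 'a"
    and a :: "nat \<Rightarrow> complex" and b :: complex
    and \<alpha> \<beta> :: "nat \<Rightarrow> complex" and \<theta> \<gamma> :: complex
  assumes "leibniz_algebra scale br"
    and "3 \<le> n"
    and "adapted_basis scale br n e"
  shows "(mu1_form scale br n \<alpha> \<theta> e \<longrightarrow>
           mu1_form scale br n \<alpha> \<theta>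
             (\<lambda>i. (tau scale br n e (a n) b n \<circ>
                     comp_upto (\<lambda>k. tau scale br n e (a k) (a k) k) (n - 1)) (e i))) \<and>
         (mu2_form scale br n \<beta> \<gamma> e \<longrightarrow>
           mu2_form scale br n \<beta> \<gamma>
             (\<lambda>i. (sigma scale br n e b n \<circ>
                     comp_upto (\<lambda>k. eta scale br n e (a k) k) n) (e i)))"
proof -
  interpret leibniz_algebra scale br by fact
  show ?thesis
  proof (intro conjI impI)
    assume mu1: "mu1_form scale br n \<alpha> \<theta> e"
    show "mu1_form scale br n \<alpha> \<theta>
        (\<lambda>i. (tau scale br n e (a n) b n \<circ>
                comp_upto (\<lambda>k. tau scale br n e (a k) (a k) k) (n - 1)) (e i))"
      using assms(2)
      by (intro mu1_form_automorphism[OF _ mu1] automorphism_comp automorphism_comp_upto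
          tau_automorphism[OF mu1]) auto
  next
    assume mu2: "mu2_form scale br n \<beta> \<gamma> e"
    show "mu2_form scale br n \<beta> \<gamma>
        (\<lambda>i. (sigma scale br n e b n \<circ>
                comp_upto (\<lambda>k. eta scale br n e (a k) k) n) (e i))"
      using assms(2)
      by (intro mu2_form_automorphism[OF _ mu2] automorphism_comp automorphism_comp_upto
          sigma_automorphism[OF mu2] eta_automorphism[OF mu2]) auto
  qed
qed

end
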